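(* Let $(\omega^1,\omega^2,\omega^3)$ be a coframing of a 3-manifold $M$ satisfying $$\begin{aligned} d\omega^1&=(A_3-C)\,\omega^1\wedge\omega^3+\omega^2\wedge\omega^3,\\ d\omega^2&=\epsilon\,\omega^1\wedge\omega^3+(A_3+C)\,\omega^2\wedge\omega^3,\\ d\omega^3&=B_3\,\omega^1\wedge\omega^2+B_2\,\omega^1\wedge\omega^3+B_1\,\omega^2\wedge\omega^3,\\ dC&=\cos(\xi)\,\omega^1+\delta\sin(\xi)\,\omega^2,\end{aligned}$$ with $\epsilon,\delta\in\{\pm1\}$, and give $M$ the Riemannian metric $g=(\omega^1)^2+(\omega^2)^2+(\omega^3)^2$. If $B_3=0$, then each leaf of the foliation defined by $\omega^3$ is flat as a submanifold of $M$ and has mean curvature $$A_3=C\cos(2\xi)-\tfrac12(\epsilon+1)\sin(2\xi).$$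
   Context: The coframing is an adapted coframe of a bi-contact structure $(\omega^1,\omega^2)$ (a pair of contact 1-forms with distinct kernels at each point of an orientable 3-manifold), in the case where the invariant function $C$, given by $\omega^1\wedge d\omega^2+\omega^2\wedge d\omega^1=2C\,\omega^1\wedge\omega^2\wedge\omega^3$, satisfies $dC\wedge\omega^1\wedge\omega^2=0$. The symbols $A_3,B_1,B_2,B_3,\xi$ denote functions on $M$; $B_3$ is the obstruction to integrability of $\omega^3$, and the leaves are the integral surfaces of $\omega^3$. The Levi-Civita connection forms of $g$ are $\omega^i_j=-\omega^j_i=\Gamma^i_{jk}\omega^k$ with $d\omega^i=-\omega^i_j\wedge\omega^j$. For a leaf $\iota:\Sigma\hookrightarrow M$, the second fundamental form is $\sum_{i,j\le2}\Gamma^3_{ij}\,\bar\omega^i\bar\omega^j$, where $\bar\omega^i=\iota^*\omega^i$; the mean curvature is $H=\Gamma^3_{11}+\Gamma^3_{22}$; and the curvature 2-form of the leaf is $\iota^*(d\omega^1_2)$, flatness meaning that this vanishes.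
   Formalization: The formula is corrected to A_3 = C cos(2ξ) − ½δ(ε+1) sin(2ξ) (the printed one fails for ε=1, δ=−1), and A_3 is proved to be the averaged mean curvature H/2, since H = Γ^3_11+Γ^3_22 equals 2A_3. *)

theory Defs
  imports "HOL-Analysis.Analysis" "HOL-Library.Function_Algebras"
begin

text \<open>Smoothness on an open subset of a Euclidean space: derivatives of all orders in all
  directions exist and are continuous.\<close>

primrec Ck_on ::
  "nat \<Rightarrow> ('a::euclidean_space \<Rightarrow> 'b::real_normed_vector) \<Rightarrow> 'a set \<Rightarrow> bool" where
  "Ck_on 0 f U \<longleftrightarrow> continuous_on U f"
| "Ck_on (Suc k) f U \<longleftrightarrow>
     (\<forall>x\<in>U. f differentiable (at x)) \<and> (\<forall>v. Ck_on k (\<lambda>x. frechet_derivative f (at x) v) U)"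

definition smooth_on ::
  "('a::euclidean_space \<Rightarrow> 'b::real_normed_vector) \<Rightarrow> 'a set \<Rightarrow> bool" where
  "smooth_on f U \<longleftrightarrow> (\<forall>k. Ck_on k f U)"


text \<open>A chart is a pair of its domain and its coordinate map. A smooth manifold is given by a
  smooth atlas (not necessarily maximal) on a Hausdorff second countable space; its dimension is
  that of the model space \<open>'e\<close>, and its underlying set is the union of the chart domains.\<close>

type_synonym ('m, 'e) chart = "'m set \<times> ('m \<Rightarrow> 'e)"

definition coord_range :: "('m, 'e) chart \<Rightarrow> 'e set" where
  "coord_range c = snd c ` fst c"

definition pt :: "('m, 'e) chart \<Rightarrow> 'e \<Rightarrow> 'm" where
  "pt c = the_inv_into (fst c) (snd c)"

definition transition :: "('m, 'e) chart \<Rightarrow> ('m, 'e) chart \<Rightarrow> 'e \<Rightarrow> 'e" where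
  "transition c d = snd d \<circ> pt c"

definition is_chart :: "('m::topological_space, 'e::euclidean_space) chart \<Rightarrow> bool" where
  "is_chart c \<longleftrightarrow> open (fst c) \<and> open (coord_range c) \<and>
     homeomorphism (fst c) (coord_range c) (snd c) (pt c)"

definition points :: "('m, 'e) chart set \<Rightarrow> 'm set" where
  "points M = (\<Union>c\<in>M. fst c)"

definition smooth_atlas ::
  "('m::{t2_space,second_countable_topology}, 'e::euclidean_space) chart set \<Rightarrow> bool" where
  "smooth_atlas M \<longleftrightarrow> (\<forall>c\<in>M. is_chart c) \<and>
     (\<forall>c\<in>M. \<forall>d\<in>M. smooth_on (transition c d) (snd c ` (fst c \<inter> fst d)))"

definition chart_at :: "('m, 'e) chart set \<Rightarrow> 'm \<Rightarrow> ('m, 'e) chart" where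
  "chart_at M p = (SOME c. c \<in> M \<and> p \<in> fst c)"

definition smooth_function ::
  "('m, 'e::euclidean_space) chart set \<Rightarrow> ('m \<Rightarrow> real) \<Rightarrow> bool" where
  "smooth_function M f \<longleftrightarrow> (\<forall>c\<in>M. smooth_on (f \<circ> pt c) (coord_range c))"


text \<open>Differential forms are families of local representatives: \<open>\<alpha> c x\<close> is the value, at the
  point with coordinate \<open>x\<close> in the chart \<open>c\<close>, on tangent vectors written in the coordinates
  of \<open>c\<close>. Representatives in overlapping charts have to correspond under the coordinate change.
  Sums, differences and negatives of forms and of functions are the pointwise ones.\<close>

type_synonym ('m, 'e) one_form = "('m, 'e) chart \<Rightarrow> 'e \<Rightarrow> 'e \<Rightarrow> real"
type_synonym ('m, 'e) two_form = "('m, 'e) chart \<Rightarrow> 'e \<Rightarrow> 'e \<Rightarrow> 'e \<Rightarrow> real"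

definition is_one_form ::
  "('m, 'e::euclidean_space) chart set \<Rightarrow> ('m, 'e) one_form \<Rightarrow> bool" where
  "is_one_form M \<alpha> \<longleftrightarrow>
     (\<forall>c\<in>M. (\<forall>x\<in>coord_range c. linear (\<alpha> c x)) \<and>
            (\<forall>v. smooth_on (\<lambda>x. \<alpha> c x v) (coord_range c))) \<and>
     (\<forall>c\<in>M. \<forall>d\<in>M. \<forall>x\<in>snd c ` (fst c \<inter> fst d). \<forall>v.
        \<alpha> c x v = \<alpha> d (transition c d x) (frechet_derivative (transition c d) (at x) v))"

text \<open>Values of representatives outside the coordinate ranges carry no meaning, so equality of
  forms on \<open>M\<close> is the following relation, used for 1-forms and for 2-forms.\<close>

definition form_eq ::
  "('m, 'e) chart set \<Rightarrow> (('m, 'e) chart \<Rightarrow> 'e \<Rightarrow> 'r) \<Rightarrow> (('m, 'e) chart \<Rightarrow> 'e \<Rightarrow> 'r) \<Rightarrow> bool" where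
  "form_eq M \<alpha> \<beta> \<longleftrightarrow> (\<forall>c\<in>M. \<forall>x\<in>coord_range c. \<alpha> c x = \<beta> c x)"

definition scale1 :: "('m \<Rightarrow> real) \<Rightarrow> ('m, 'e) one_form \<Rightarrow> ('m, 'e) one_form"
    (infixr "\<odot>\<^sub>1" 75) where
  "f \<odot>\<^sub>1 \<alpha> = (\<lambda>c x v. f (pt c x) * \<alpha> c x v)"

definition scale2 :: "('m \<Rightarrow> real) \<Rightarrow> ('m, 'e) two_form \<Rightarrow> ('m, 'e) two_form"
    (infixr "\<odot>\<^sub>2" 75) where
  "f \<odot>\<^sub>2 \<beta> = (\<lambda>c x v w. f (pt c x) * \<beta> c x v w)"

definition wedge :: "('m, 'e) one_form \<Rightarrow> ('m, 'e) one_form \<Rightarrow> ('m, 'e) two_form"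
    (infixl "\<^bold>\<and>" 80) where
  "\<alpha> \<^bold>\<and> \<beta> = (\<lambda>c x v w. \<alpha> c x v * \<beta> c x w - \<alpha> c x w * \<beta> c x v)"

definition ext_d0 :: "('m \<Rightarrow> real) \<Rightarrow> ('m, 'e::euclidean_space) one_form" where
  "ext_d0 f = (\<lambda>c x v. frechet_derivative (f \<circ> pt c) (at x) v)"

definition ext_d1 :: "('m, 'e::euclidean_space) one_form \<Rightarrow> ('m, 'e) two_form" where
  "ext_d1 \<alpha> = (\<lambda>c x v w.
     frechet_derivative (\<lambda>x. \<alpha> c x w) (at x) v - frechet_derivative (\<lambda>x. \<alpha> c x v) (at x) w)"

definition coframing :: "('m, real^3) chart set \<Rightarrow> (3 \<Rightarrow> ('m, real^3) one_form) \<Rightarrow> bool" where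
  "coframing M \<omega> \<longleftrightarrow> (\<forall>i. is_one_form M (\<omega> i)) \<and>
     (\<forall>c\<in>M. \<forall>x\<in>coord_range c. \<forall>a::3 \<Rightarrow> real.
        (\<forall>v. (\<Sum>i\<in>UNIV. a i * \<omega> i c x v) = 0) \<longrightarrow> (\<forall>i. a i = 0))"


text \<open>Metrics are families of local representatives as well. The coefficients \<open>\<Gamma> i j k\<close> stand for
  \<open>\<Gamma>\<^sup>i\<^sub>j\<^sub>k\<close>; the connection forms are characterised by skew symmetry and the first structure
  equation, relative to an orthonormal coframing.\<close>

definition coframe_metric ::
  "(3 \<Rightarrow> ('m, 'e) one_form) \<Rightarrow> ('m, 'e) chart \<Rightarrow> 'e \<Rightarrow> 'e \<Rightarrow> 'e \<Rightarrow> real" where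
  "coframe_metric \<omega> = (\<lambda>c x v w. \<Sum>i\<in>UNIV. \<omega> i c x v * \<omega> i c x w)"

definition orthonormal_coframing ::
  "('m, real^3) chart set \<Rightarrow> (('m, real^3) chart \<Rightarrow> real^3 \<Rightarrow> real^3 \<Rightarrow> real^3 \<Rightarrow> real) \<Rightarrow>
     (3 \<Rightarrow> ('m, real^3) one_form) \<Rightarrow> bool" where
  "orthonormal_coframing M g \<omega> \<longleftrightarrow> coframing M \<omega> \<and> form_eq M g (coframe_metric \<omega>)"

definition connection_form ::
  "(3 \<Rightarrow> 3 \<Rightarrow> 3 \<Rightarrow> 'm \<Rightarrow> real) \<Rightarrow> (3 \<Rightarrow> ('m, 'e) one_form) \<Rightarrow> 3 \<Rightarrow> 3 \<Rightarrow> ('m, 'e) one_form" where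
  "connection_form \<Gamma> \<omega> i j = (\<Sum>k\<in>UNIV. \<Gamma> i j k \<odot>\<^sub>1 \<omega> k)"

definition levi_civita ::
  "('m, real^3) chart set \<Rightarrow> (('m, real^3) chart \<Rightarrow> real^3 \<Rightarrow> real^3 \<Rightarrow> real^3 \<Rightarrow> real) \<Rightarrow>
     (3 \<Rightarrow> ('m, real^3) one_form) \<Rightarrow> (3 \<Rightarrow> 3 \<Rightarrow> 3 \<Rightarrow> 'm \<Rightarrow> real) \<Rightarrow> bool" where
  "levi_civita M g \<omega> \<Gamma> \<longleftrightarrow>
     orthonormal_coframing M g \<omega> \<and>
     (\<forall>i j k. smooth_function M (\<Gamma> i j k)) \<and>
     (\<forall>i j. form_eq M (connection_form \<Gamma> \<omega> i j) (- connection_form \<Gamma> \<omega> j i)) \<and>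
     (\<forall>i. form_eq M (ext_d1 (\<omega> i)) (- (\<Sum>j\<in>UNIV. connection_form \<Gamma> \<omega> i j \<^bold>\<and> \<omega> j)))"


text \<open>Smooth maps, pullbacks, and integral surfaces. A pullback is computed in some chart of the
  target around the image point; for forms on \<open>M\<close> the choice is immaterial.\<close>

definition local_rep ::
  "('s \<Rightarrow> 'm) \<Rightarrow> ('s, 'f) chart \<Rightarrow> ('m, 'e) chart \<Rightarrow> 'f \<Rightarrow> 'e" where
  "local_rep \<iota> d c = snd c \<circ> \<iota> \<circ> pt d"

definition smooth_map ::
  "('s::topological_space, 'f::euclidean_space) chart set \<Rightarrow>
     ('m::topological_space, 'e::euclidean_space) chart set \<Rightarrow> ('s \<Rightarrow> 'm) \<Rightarrow> bool" where
  "smooth_map S M \<iota> \<longleftrightarrow> \<iota> ` points S \<subseteq> points M \<and> continuous_on (points S) \<iota> \<and>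
     (\<forall>d\<in>S. \<forall>c\<in>M. smooth_on (local_rep \<iota> d c) (snd d ` (fst d \<inter> \<iota> -` fst c)))"

definition immersion ::
  "('s::topological_space, 'f::euclidean_space) chart set \<Rightarrow>
     ('m::topological_space, 'e::euclidean_space) chart set \<Rightarrow> ('s \<Rightarrow> 'm) \<Rightarrow> bool" where
  "immersion S M \<iota> \<longleftrightarrow> smooth_map S M \<iota> \<and>
     (\<forall>d\<in>S. \<forall>c\<in>M. \<forall>y\<in>snd d ` (fst d \<inter> \<iota> -` fst c).
        inj (frechet_derivative (local_rep \<iota> d c) (at y)))"

definition pullback1 ::
  "('m, 'e::euclidean_space) chart set \<Rightarrow> ('s \<Rightarrow> 'm) \<Rightarrow> ('m, 'e) one_form \<Rightarrow>
     ('s, 'f::euclidean_space) one_form" where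
  "pullback1 M \<iota> \<alpha> = (\<lambda>d y v.
     let c = chart_at M (\<iota> (pt d y)); F = local_rep \<iota> d c
     in \<alpha> c (F y) (frechet_derivative F (at y) v))"

definition pullback2 ::
  "('m, 'e::euclidean_space) chart set \<Rightarrow> ('s \<Rightarrow> 'm) \<Rightarrow> ('m, 'e) two_form \<Rightarrow>
     ('s, 'f::euclidean_space) two_form" where
  "pullback2 M \<iota> \<beta> = (\<lambda>d y v w.
     let c = chart_at M (\<iota> (pt d y)); F = local_rep \<iota> d c
     in \<beta> c (F y) (frechet_derivative F (at y) v) (frechet_derivative F (at y) w))"

text \<open>Maximality and connectedness are not required, so the leaves of the foliation are among
  these surfaces.\<close>

definition integral_surface ::
  "('m::{t2_space,second_countable_topology}, real^3) chart set \<Rightarrow> ('m, real^3) one_form \<Rightarrow>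
     ('s::{t2_space,second_countable_topology}, real^2) chart set \<Rightarrow> ('s \<Rightarrow> 'm) \<Rightarrow> bool" where
  "integral_surface M \<eta> S \<iota> \<longleftrightarrow> smooth_atlas S \<and> immersion S M \<iota> \<and> inj_on \<iota> (points S) \<and>
     form_eq S (pullback1 M \<iota> \<eta>) 0"

definition flat_leaf ::
  "('m, real^3) chart set \<Rightarrow> (3 \<Rightarrow> ('m, real^3) one_form) \<Rightarrow> (3 \<Rightarrow> 3 \<Rightarrow> 3 \<Rightarrow> 'm \<Rightarrow> real) \<Rightarrow>
     ('s, real^2) chart set \<Rightarrow> ('s \<Rightarrow> 'm) \<Rightarrow> bool" where
  "flat_leaf M \<omega> \<Gamma> S \<iota> \<longleftrightarrow> form_eq S (pullback2 M \<iota> (ext_d1 (connection_form \<Gamma> \<omega> 1 2))) 0"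

text \<open>The second fundamental form of a leaf has coefficients \<open>\<Gamma>\<^sup>3\<^sub>i\<^sub>j\<close>, for \<open>i, j \<le> 2\<close>, in the
  orthonormal coframing induced by \<open>\<omega> 1\<close> and \<open>\<omega> 2\<close>. The function \<open>H\<close> is its trace, that is,
  the sum (not the average) of the principal curvatures.\<close>

definition leaf_H :: "(3 \<Rightarrow> 3 \<Rightarrow> 3 \<Rightarrow> 'm \<Rightarrow> real) \<Rightarrow> ('s \<Rightarrow> 'm) \<Rightarrow> 's \<Rightarrow> real" where
  "leaf_H \<Gamma> \<iota> q = \<Gamma> 3 1 1 (\<iota> q) + \<Gamma> 3 2 2 (\<iota> q)"

end

theory Submission
  imports Defs
begin

text \<open>Evaluating \<open>d(dC) = 0\<close> on the pairs \<open>(e\<^sub>1, e\<^sub>3)\<close> and \<open>(e\<^sub>2, e\<^sub>3)\<close> of the dual frame gives two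
  equations that are linear in \<open>d\<xi>(e\<^sub>3)\<close>; eliminating it with the weights \<open>cos \<xi>\<close> and \<open>\<delta> sin \<xi>\<close>
  yields the formula for \<open>A\<^sub>3\<close>. The forms \<open>d\<omega>\<^sup>1\<close> and \<open>d\<omega>\<^sup>2\<close> have no \<open>\<omega>\<^sup>1 \<and> \<omega>\<^sup>2\<close> term, so
  \<open>\<Gamma>\<^sup>1\<^sub>2\<^sub>1 = \<Gamma>\<^sup>1\<^sub>2\<^sub>2 = 0\<close> and \<open>\<omega>\<^sup>1\<^sub>2\<close> is a multiple of \<open>\<omega>\<^sup>3\<close>. If \<open>B\<^sub>3 = 0\<close>, then \<open>d\<omega>\<^sup>3\<close>, and hence also
  \<open>d\<omega>\<^sup>1\<^sub>2\<close>, lies in the ideal generated by \<open>\<omega>\<^sup>3\<close>, which vanishes on the leaves. The structure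
  equations also give \<open>\<Gamma>\<^sup>3\<^sub>1\<^sub>1 = A\<^sub>3 - C\<close> and \<open>\<Gamma>\<^sup>3\<^sub>2\<^sub>2 = A\<^sub>3 + C\<close>.\<close>

section \<open>Symmetry of mixed second derivatives\<close>

text \<open>Two applications of the mean value theorem, first along \<open>v\<close> and then along
  \<open>w\<close>, turn the second difference over the parallelogram with sides \<open>h v\<close>
  and \<open>h w\<close> into a mixed derivative at an interior point.\<close>

lemma second_difference_mean_value:
  fixes f :: "'a::real_normed_vector \<Rightarrow> real"
  assumes "0 < h"
    and f: "\<And>s t. s \<in> {0..h} \<Longrightarrow> t \<in> {0..h} \<Longrightarrow>
      (f has_derivative f' (x + s *\<^sub>R v + t *\<^sub>R w)) (at (x + s *\<^sub>R v + t *\<^sub>R w))"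
    and f': "\<And>s t. s \<in> {0..h} \<Longrightarrow> t \<in> {0..h} \<Longrightarrow>
      ((\<lambda>y. f' y v) has_derivative f'' (x + s *\<^sub>R v + t *\<^sub>R w)) (at (x + s *\<^sub>R v + t *\<^sub>R w))"
  obtains s t where "s \<in> {0<..<h}" "t \<in> {0<..<h}"
    "f (x + h *\<^sub>R v + h *\<^sub>R w) - f (x + h *\<^sub>R v) - f (x + h *\<^sub>R w) + f x =
      h * h * f'' (x + s *\<^sub>R v + t *\<^sub>R w) w"
proof -
  \<comment> \<open>The second difference is \<open>\<phi> h - \<phi> 0\<close>. The term
    \<open>0 *\<^sub>R w\<close> is kept so that both summands are cases \<open>t = h\<close> and
    \<open>t = 0\<close> of one pattern.\<close>
  define \<phi> where "\<phi> s = f (x + s *\<^sub>R v + h *\<^sub>R w) - f (x + s *\<^sub>R v + 0 *\<^sub>R w)" for s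
  have d\<phi>: "(\<phi> has_derivative (\<lambda>k. f' (x + s *\<^sub>R v + h *\<^sub>R w) (k *\<^sub>R v)
      - f' (x + s *\<^sub>R v + 0 *\<^sub>R w) (k *\<^sub>R v))) (at s within {0..h})" if "0 \<le> s" "s \<le> h" for s
  proof -
    have "((\<lambda>s. f (x + s *\<^sub>R v + t *\<^sub>R w)) has_derivative
        (\<lambda>k. f' (x + s *\<^sub>R v + t *\<^sub>R w) (k *\<^sub>R v))) (at s within {0..h})" if "t \<in> {0..h}" for t
      by (rule has_derivative_compose[where f = "\<lambda>s. x + s *\<^sub>R v + t *\<^sub>R w", OF _ f])
        (use that \<open>0 \<le> s\<close> \<open>s \<le> h\<close> in \<open>auto intro!: derivative_eq_intros\<close>)
    from this[of h] this[of 0] show ?thesis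
      unfolding \<phi>_def using \<open>0 < h\<close> by (intro has_derivative_diff) auto
  qed
  obtain s where s: "s \<in> {0<..<h}"
    and s_eq: "\<phi> h - \<phi> 0 = f' (x + s *\<^sub>R v + h *\<^sub>R w) ((h - 0) *\<^sub>R v)
      - f' (x + s *\<^sub>R v + 0 *\<^sub>R w) ((h - 0) *\<^sub>R v)"
    using mvt_simple[OF \<open>0 < h\<close> d\<phi>] by blast
  have lin: "linear (f' (x + s *\<^sub>R v + t *\<^sub>R w))" if "t \<in> {0..h}" for t
    using f[of s t] s that has_derivative_linear by fastforce
  have "((\<lambda>t. f' (x + s *\<^sub>R v + t *\<^sub>R w) v) has_derivative
      (\<lambda>k. f'' (x + s *\<^sub>R v + t *\<^sub>R w) (k *\<^sub>R w))) (at t within {0..h})" if "0 \<le> t" "t \<le> h" for t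
    by (rule has_derivative_compose[where f = "\<lambda>t. x + s *\<^sub>R v + t *\<^sub>R w", OF _ f'])
      (use that s in \<open>auto intro!: derivative_eq_intros\<close>)
  from mvt_simple[OF \<open>0 < h\<close> this] obtain t where t: "t \<in> {0<..<h}"
    and t_eq: "f' (x + s *\<^sub>R v + h *\<^sub>R w) v - f' (x + s *\<^sub>R v + 0 *\<^sub>R w) v
      = f'' (x + s *\<^sub>R v + t *\<^sub>R w) ((h - 0) *\<^sub>R w)"
    by blast
  have "linear (f'' (x + s *\<^sub>R v + t *\<^sub>R w))"
    using f'[of s t] s t has_derivative_linear by fastforce
  then have "f' (x + s *\<^sub>R v + h *\<^sub>R w) v - f' (x + s *\<^sub>R v + 0 *\<^sub>R w) v
      = h * f'' (x + s *\<^sub>R v + t *\<^sub>R w) w"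
    using t_eq by (simp add: linear_cmul)
  moreover have "\<phi> h - \<phi> 0 = h * (f' (x + s *\<^sub>R v + h *\<^sub>R w) v - f' (x + s *\<^sub>R v + 0 *\<^sub>R w) v)"
    using s_eq lin[of h] lin[of 0] \<open>0 < h\<close> by (simp add: linear_cmul right_diff_distrib)
  ultimately have "\<phi> h - \<phi> 0 = h * h * f'' (x + s *\<^sub>R v + t *\<^sub>R w) w"
    by simp
  then show ?thesis
    using s t that by (simp add: \<phi>_def)
qed

text \<open>The second difference does not change when \<open>v\<close> and \<open>w\<close> are
  exchanged. Hence the two mixed derivatives take a common value at points arbitrarily close to
  \<open>x\<close>, and continuity carries the equality to \<open>x\<close>.\<close>

lemma mixed_derivatives_commute:
  fixes f :: "'a::real_normed_vector \<Rightarrow> real"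
  assumes "open U" "x \<in> U"
    and f: "\<And>y. y \<in> U \<Longrightarrow> (f has_derivative f' y) (at y)"
    and f'v: "\<And>y. y \<in> U \<Longrightarrow> ((\<lambda>y. f' y v) has_derivative f''v y) (at y)"
    and f'w: "\<And>y. y \<in> U \<Longrightarrow> ((\<lambda>y. f' y w) has_derivative f''w y) (at y)"
    and cont: "continuous_on U (\<lambda>y. f''v y w)" "continuous_on U (\<lambda>y. f''w y v)"
  shows "f''v x w = f''w x v"
proof (rule ccontr)
  assume "f''v x w \<noteq> f''w x v"
  \<comment> \<open>With half the gap as radius, no number lies within \<open>e\<close> of both
    values.\<close>
  define e where "e = dist (f''v x w) (f''w x v) / 2"
  have "0 < e"
    using \<open>f''v x w \<noteq> f''w x v\<close> by (simp add: e_def)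
  have "isCont (\<lambda>y. f''v y w) x" "isCont (\<lambda>y. f''w y v) x"
    using cont assms(1,2) continuous_on_eq_continuous_at by blast+
  then have "((\<lambda>y. f''v y w) \<longlongrightarrow> f''v x w) (nhds x)" "((\<lambda>y. f''w y v) \<longlongrightarrow> f''w x v) (nhds x)"
    using tendsto_at_iff_tendsto_nhds[of "\<lambda>y. f''v y w" x] tendsto_at_iff_tendsto_nhds[of "\<lambda>y. f''w y v" x]
    by (simp_all only: isCont_def)
  from tendstoD[OF this(1) \<open>0 < e\<close>] tendstoD[OF this(2) \<open>0 < e\<close>]
  have "\<forall>\<^sub>F y in nhds x. dist (f''v y w) (f''v x w) < e"
    "\<forall>\<^sub>F y in nhds x. dist (f''w y v) (f''w x v) < e" .
  moreover have "\<forall>\<^sub>F y in nhds x. y \<in> U"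
    using assms(1,2) by (simp add: eventually_nhds_in_open)
  ultimately have "\<forall>\<^sub>F y in nhds x. y \<in> U \<and> dist (f''v y w) (f''v x w) < e \<and>
      dist (f''w y v) (f''w x v) < e"
    by eventually_elim simp
  then obtain r where "0 < r" and r: "\<And>y. dist y x < r \<Longrightarrow>
      y \<in> U \<and> dist (f''v y w) (f''v x w) < e \<and> dist (f''w y v) (f''w x v) < e"
    by (auto simp: eventually_nhds_metric)
  \<comment> \<open>This size keeps both parallelograms within distance \<open>r\<close> of
    \<open>x\<close>; the summand 1 covers the case \<open>v = w = 0\<close>.\<close>
  define h where "h = r / (norm v + norm w + 1)"
  have "0 < norm v + norm w + 1"
    by (simp add: add_nonneg_pos)
  then have "0 < h" and h: "h * (norm v + norm w) < r"
    using \<open>0 < r\<close> by (simp_all add: h_def field_simps)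
  have near: "dist (x + s *\<^sub>R v + t *\<^sub>R w) x < r" if "s \<in> {0..h}" "t \<in> {0..h}" for s t
  proof -
    have "dist (x + s *\<^sub>R v + t *\<^sub>R w) x = norm (s *\<^sub>R v + t *\<^sub>R w)"
      by (simp add: dist_norm)
    also have "\<dots> \<le> s * norm v + t * norm w"
      using that norm_triangle_ineq[of "s *\<^sub>R v" "t *\<^sub>R w"] by simp
    also have "\<dots> \<le> h * norm v + h * norm w"
      using that by (intro add_mono mult_right_mono) auto
    finally show ?thesis
      using h by (simp add: distrib_left)
  qed
  have near': "dist (x + s *\<^sub>R w + t *\<^sub>R v) x < r" if "s \<in> {0..h}" "t \<in> {0..h}" for s t
    using near[OF that(2,1)] by (simp add: ac_simps)
  obtain s t where st: "s \<in> {0<..<h}" "t \<in> {0<..<h}"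
    and v: "f (x + h *\<^sub>R v + h *\<^sub>R w) - f (x + h *\<^sub>R v) - f (x + h *\<^sub>R w) + f x =
      h * h * f''v (x + s *\<^sub>R v + t *\<^sub>R w) w"
    using second_difference_mean_value[OF \<open>0 < h\<close> f[OF conjunct1[OF r[OF near]]]
        f'v[OF conjunct1[OF r[OF near]]]] by metis
  obtain s' t' where st': "s' \<in> {0<..<h}" "t' \<in> {0<..<h}"
    and w: "f (x + h *\<^sub>R w + h *\<^sub>R v) - f (x + h *\<^sub>R w) - f (x + h *\<^sub>R v) + f x =
      h * h * f''w (x + s' *\<^sub>R w + t' *\<^sub>R v) v"
    using second_difference_mean_value[OF \<open>0 < h\<close> f[OF conjunct1[OF r[OF near']]]
        f'w[OF conjunct1[OF r[OF near']]]] by metis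
  \<comment> \<open>Both sides, multiplied by \<open>h * h\<close>, are the same second difference
    of \<open>f\<close>.\<close>
  have "f''v (x + s *\<^sub>R v + t *\<^sub>R w) w = f''w (x + s' *\<^sub>R w + t' *\<^sub>R v) v"
  proof -
    have swap: "x + h *\<^sub>R w + h *\<^sub>R v = x + h *\<^sub>R v + h *\<^sub>R w"
      by simp
    have "h * h * f''v (x + s *\<^sub>R v + t *\<^sub>R w) w = h * h * f''w (x + s' *\<^sub>R w + t' *\<^sub>R v) v"
      using v w[unfolded swap] by linarith
    then show ?thesis
      using \<open>0 < h\<close> by simp
  qed
  moreover have "dist (f''v (x + s *\<^sub>R v + t *\<^sub>R w) w) (f''v x w) < e"
    "dist (f''w (x + s' *\<^sub>R w + t' *\<^sub>R v) v) (f''w x v) < e"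
    using r[OF near[of s t]] r[OF near'[of s' t']] st st' by auto
  ultimately show False
    using dist_triangle_half_r unfolding e_def by fastforce
qed

section \<open>Linear algebra: dual bases\<close>

text \<open>The forms are the components of one linear map \<open>L\<close>. A nonzero vector
  orthogonal to the range of \<open>L\<close> would give a linear relation between them, so
  \<open>L\<close> is onto, and preimages of the coordinate vectors form the dual basis.\<close>

lemma dual_basis_exists:
  fixes \<alpha> :: "3 \<Rightarrow> real^3 \<Rightarrow> real"
  assumes "\<And>i. linear (\<alpha> i)"
    and indep: "\<And>a. (\<And>v. (\<Sum>i\<in>UNIV. a i * \<alpha> i v) = 0) \<Longrightarrow> \<forall>i. a i = 0"
  obtains e where "\<And>i j. \<alpha> i (e j) = (if i = j then 1 else 0)"
proof -
  define L where "L v = (\<chi> i. \<alpha> i v)" for v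
  have "linear L"
    using assms(1) by (auto intro!: linearI simp: L_def vec_eq_iff linear_add linear_cmul)
  have "span (range L) = UNIV"
  proof (rule ccontr)
    assume "span (range L) \<noteq> UNIV"
    then have "span (range L) \<subset> span UNIV"
      by auto
    then obtain a where "a \<noteq> 0" and a: "\<And>y. y \<in> span (range L) \<Longrightarrow> orthogonal a y"
      using orthogonal_to_subspace_exists_gen by metis
    have "(\<Sum>i\<in>UNIV. a $ i * \<alpha> i v) = 0" for v
      using a[of "L v"] by (simp add: span_base orthogonal_def inner_vec_def L_def)
    then show False
      using indep[of "($) a"] \<open>a \<noteq> 0\<close> by (simp add: vec_eq_iff)
  qed
  then have "surj L"
    using span_linear_image[OF \<open>linear L\<close>, of UNIV] by simp
  then have "\<exists>v. L v = axis j 1" for j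
    by (metis surjD)
  then obtain e where e: "\<And>j. L (e j) = axis j 1"
    by metis
  have "L (e j) $ i = (if i = j then 1 else 0)" for i j
    unfolding e by (simp add: axis_def)
  then have "\<alpha> i (e j) = (if i = j then 1 else 0)" for i j
    by (simp add: L_def)
  then show ?thesis
    by (rule that)
qed

section \<open>Smooth functions, charts and points\<close>

lemma smooth_on_has_derivative:
  assumes "smooth_on f U" "x \<in> U"
  shows "(f has_derivative frechet_derivative f (at x)) (at x)"
proof -
  have "Ck_on (Suc 0) f U"
    using assms(1) unfolding smooth_on_def by blast
  then show ?thesis
    using assms(2) by (simp add: frechet_derivative_works)
qed

lemma smooth_on_frechet_derivative:
  assumes "smooth_on f U"
  shows "smooth_on (\<lambda>x. frechet_derivative f (at x) v) U"
  unfolding smooth_on_def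
proof
  fix k
  have "Ck_on (Suc k) f U"
    using assms unfolding smooth_on_def by blast
  then show "Ck_on k (\<lambda>x. frechet_derivative f (at x) v) U"
    by simp
qed

lemma smooth_on_continuous_on: "smooth_on f U \<Longrightarrow> continuous_on U f"
  unfolding smooth_on_def by (metis Ck_on.simps(1))

lemma open_coord_range: "smooth_atlas M \<Longrightarrow> c \<in> M \<Longrightarrow> open (coord_range c)"
  by (simp add: smooth_atlas_def is_chart_def)

lemma pt_coord [simp]:
  assumes "smooth_atlas M" "c \<in> M" "p \<in> fst c"
  shows "pt c (snd c p) = p"
proof -
  have "homeomorphism (fst c) (coord_range c) (snd c) (pt c)"
    using assms by (simp add: smooth_atlas_def is_chart_def)
  then show ?thesis
    using assms(3) by (simp add: homeomorphism_def)
qed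

lemma pt_in_chart:
  assumes "smooth_atlas M" "c \<in> M" "x \<in> coord_range c"
  shows "pt c x \<in> fst c"
  using assms pt_coord[OF assms(1,2)] by (auto simp: coord_range_def)

lemma pt_in_points:
  assumes "smooth_atlas M" "c \<in> M" "x \<in> coord_range c"
  shows "pt c x \<in> points M"
  using assms(2) pt_in_chart[OF assms] by (auto simp: points_def)

lemma points_cases:
  assumes "smooth_atlas M" "p \<in> points M"
  obtains c x where "c \<in> M" "x \<in> coord_range c" "pt c x = p"
proof -
  obtain c where "c \<in> M" "p \<in> fst c"
    using assms(2) by (auto simp: points_def)
  then show ?thesis
    using assms(1) by (intro that[of c "snd c p"]) (auto simp: coord_range_def)
qed

lemma chart_at:
  assumes "p \<in> points M"
  shows "chart_at M p \<in> M" "p \<in> fst (chart_at M p)"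
proof -
  have "\<exists>c. c \<in> M \<and> p \<in> fst c"
    using assms by (auto simp: points_def)
  then have "chart_at M p \<in> M \<and> p \<in> fst (chart_at M p)"
    unfolding chart_at_def by (rule someI_ex)
  then show "chart_at M p \<in> M" "p \<in> fst (chart_at M p)"
    by auto
qed

section \<open>Calculus of the exterior derivative on local representatives\<close>

lemma ext_d0_has_derivative:
  assumes "smooth_function M f" "c \<in> M" "x \<in> coord_range c"
  shows "((\<lambda>x. f (pt c x)) has_derivative ext_d0 f c x) (at x)"
  using assms smooth_on_has_derivative[of "f \<circ> pt c" "coord_range c" x]
  by (simp add: smooth_function_def ext_d0_def[abs_def] comp_def)

lemma ext_d0_eqI:
  assumes "((\<lambda>x. f (pt c x)) has_derivative D) (at x)"
  shows "ext_d0 f c x = D"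
  using frechet_derivative_at[OF assms] by (simp add: ext_d0_def comp_def)

lemma one_form_has_derivative:
  assumes "is_one_form M \<alpha>" "c \<in> M" "x \<in> coord_range c"
  shows "((\<lambda>x. \<alpha> c x v) has_derivative frechet_derivative (\<lambda>x. \<alpha> c x v) (at x)) (at x)"
  using assms by (intro smooth_on_has_derivative) (auto simp: is_one_form_def)

lemma ext_d1_eqI:
  assumes "((\<lambda>x. \<alpha> c x w) has_derivative D) (at x)" "((\<lambda>x. \<alpha> c x v) has_derivative E) (at x)"
  shows "ext_d1 \<alpha> c x v w = D v - E w"
  by (simp add: ext_d1_def frechet_derivative_at[OF assms(1), symmetric]
      frechet_derivative_at[OF assms(2), symmetric])

text \<open>Coordinate ranges are open, so derivatives at their points depend only on the values
  that \<open>form_eq\<close> compares. This allows an identity between 1-forms to be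
  differentiated.\<close>

lemma form_eq_ext_d1:
  assumes "smooth_atlas M" "form_eq M \<alpha> \<beta>"
  shows "form_eq M (ext_d1 \<alpha>) (ext_d1 \<beta>)"
  unfolding form_eq_def
proof (intro ballI ext)
  fix c x v w
  assume c: "c \<in> M" and x: "x \<in> coord_range c"
  have eq: "\<forall>y\<in>coord_range c. \<alpha> c y = \<beta> c y"
    using assms(2) c by (simp add: form_eq_def)
  have "((\<lambda>y. \<alpha> c y u) has_derivative D) (at x) \<longleftrightarrow> ((\<lambda>y. \<beta> c y u) has_derivative D) (at x)" for u D
    using eq has_derivative_transform_within_open[OF _ open_coord_range[OF assms(1) c] x] by metis
  then have "frechet_derivative (\<lambda>y. \<alpha> c y u) (at x) = frechet_derivative (\<lambda>y. \<beta> c y u) (at x)" for u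
    unfolding frechet_derivative_def by simp
  then show "ext_d1 \<alpha> c x v w = ext_d1 \<beta> c x v w"
    by (simp add: ext_d1_def)
qed

text \<open>In a chart, \<open>d(df) = 0\<close> is the symmetry of second derivatives of the local
  representative of \<open>f\<close>.\<close>

lemma ext_d1_ext_d0:
  assumes "smooth_atlas M" "smooth_function M f"
  shows "form_eq M (ext_d1 (ext_d0 f)) 0"
  unfolding form_eq_def
proof (intro ballI ext)
  fix c x v w
  assume c: "c \<in> M" and x: "x \<in> coord_range c"
  define U where "U = coord_range c"
  define F where "F = f \<circ> pt c"
  have F: "smooth_on F U"
    using assms(2) c by (simp add: smooth_function_def F_def U_def)
  have "frechet_derivative (\<lambda>y. frechet_derivative F (at y) w) (at x) v =
      frechet_derivative (\<lambda>y. frechet_derivative F (at y) v) (at x) w"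
  proof (rule mixed_derivatives_commute[where U = U and f = F])
    show "open U" "x \<in> U"
      using open_coord_range[OF assms(1) c] x by (simp_all add: U_def)
  qed (use F in \<open>blast intro: smooth_on_has_derivative smooth_on_frechet_derivative
        smooth_on_continuous_on\<close>)+
  then show "ext_d1 (ext_d0 f) c x v w = 0 c x v w"
    by (simp add: ext_d1_def ext_d0_def F_def zero_fun_def)
qed

text \<open>The derivative of the coefficient enters as an arbitrary \<open>D\<close> at a single
  point. Coefficients such as \<open>cos (\<xi> p)\<close> can then be treated by the chain rule,
  without first being shown to be smooth functions on \<open>M\<close>.\<close>

lemma scale1_has_derivative:
  assumes "((\<lambda>x. f (pt c x)) has_derivative D) (at x)"
    and "is_one_form M \<alpha>" "c \<in> M" "x \<in> coord_range c"
  shows "((\<lambda>x. (f \<odot>\<^sub>1 \<alpha>) c x v) has_derivative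
    (\<lambda>u. f (pt c x) * frechet_derivative (\<lambda>x. \<alpha> c x v) (at x) u + D u * \<alpha> c x v)) (at x)"
  unfolding scale1_def by (rule has_derivative_mult[OF assms(1) one_form_has_derivative[OF assms(2-4)]])

lemma ext_d1_scale1:
  assumes "((\<lambda>x. f (pt c x)) has_derivative D) (at x)"
    and "is_one_form M \<alpha>" "c \<in> M" "x \<in> coord_range c"
  shows "ext_d1 (f \<odot>\<^sub>1 \<alpha>) c x v w = (ext_d0 f \<^bold>\<and> \<alpha> + f \<odot>\<^sub>2 ext_d1 \<alpha>) c x v w"
proof -
  have "ext_d1 (f \<odot>\<^sub>1 \<alpha>) c x v w =
      (f (pt c x) * frechet_derivative (\<lambda>x. \<alpha> c x w) (at x) v + D v * \<alpha> c x w) -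
      (f (pt c x) * frechet_derivative (\<lambda>x. \<alpha> c x v) (at x) w + D w * \<alpha> c x v)"
    by (rule ext_d1_eqI) (rule scale1_has_derivative[OF assms])+
  then show ?thesis
    by (simp add: ext_d0_eqI[OF assms(1)] wedge_def scale2_def ext_d1_def algebra_simps)
qed

lemma ext_d1_add:
  assumes "\<And>v. (\<lambda>x. \<alpha> c x v) differentiable (at x)" "\<And>v. (\<lambda>x. \<beta> c x v) differentiable (at x)"
  shows "ext_d1 (\<alpha> + \<beta>) c x v w = (ext_d1 \<alpha> + ext_d1 \<beta>) c x v w"
proof -
  have "((\<lambda>x. (\<alpha> + \<beta>) c x v) has_derivative (\<lambda>u. frechet_derivative (\<lambda>x. \<alpha> c x v) (at x) u +
      frechet_derivative (\<lambda>x. \<beta> c x v) (at x) u)) (at x)" for v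
    unfolding plus_fun_apply using assms frechet_derivative_works by (intro has_derivative_add) blast+
  note d = this
  show ?thesis
    by (simp add: ext_d1_eqI[of "\<alpha> + \<beta>", OF d d]) (simp add: ext_d1_def)
qed

section \<open>Dual frames and the Levi-Civita coefficients\<close>

lemma coframing_dual_basis:
  assumes "coframing M \<omega>" "c \<in> M" "x \<in> coord_range c"
  obtains e where "\<And>i j. \<omega> i c x (e j) = (if i = j then 1 else 0)"
proof (rule dual_basis_exists[of "\<lambda>i. \<omega> i c x"])
  show "linear (\<omega> i c x)" for i
    using assms by (auto simp: coframing_def is_one_form_def)
  show "\<forall>i. a i = 0" if "\<And>v. (\<Sum>i\<in>UNIV. a i * \<omega> i c x v) = 0" for a
    using assms that unfolding coframing_def by blast
qed (rule that)

text \<open>On the dual frame the connection form with indices \<open>i\<close>, \<open>j\<close>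
  takes the value \<open>\<Gamma> i j k\<close> at \<open>e k\<close>. In the first structure
  equation evaluated on \<open>e j\<close> and \<open>e k\<close>, the form
  \<open>\<omega> l\<close> selects the summands \<open>l = j\<close> and
  \<open>l = k\<close>.\<close>

lemma levi_civita_coefficients:
  assumes "levi_civita M g \<omega> \<Gamma>" "c \<in> M" "x \<in> coord_range c"
    and e: "\<And>i j. \<omega> i c x (e j) = (if i = j then 1 else 0)"
  shows "\<Gamma> i j k (pt c x) = - \<Gamma> j i k (pt c x)"
    and "ext_d1 (\<omega> i) c x (e j) (e k) = \<Gamma> i j k (pt c x) - \<Gamma> i k j (pt c x)"
proof -
  have conn: "connection_form \<Gamma> \<omega> i j c x (e k) = \<Gamma> i j k (pt c x)" for i j k
    using exhaust_3[of k] by (auto simp: connection_form_def sum_3 scale1_def e)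
  have "connection_form \<Gamma> \<omega> i j c x = (- connection_form \<Gamma> \<omega> j i) c x"
    using assms(1-3) unfolding levi_civita_def form_eq_def by blast
  then show "\<Gamma> i j k (pt c x) = - \<Gamma> j i k (pt c x)"
    by (simp flip: conn)
  have "ext_d1 (\<omega> i) c x = (- (\<Sum>l\<in>UNIV. connection_form \<Gamma> \<omega> i l \<^bold>\<and> \<omega> l)) c x"
    using assms(1-3) unfolding levi_civita_def form_eq_def by blast
  then have "ext_d1 (\<omega> i) c x (e j) (e k) =
      - (\<Sum>l\<in>UNIV. connection_form \<Gamma> \<omega> i l \<^bold>\<and> \<omega> l) c x (e j) (e k)"
    by simp
  also have "\<dots> = \<Gamma> i j k (pt c x) - \<Gamma> i k j (pt c x)"
    using exhaust_3[of j] exhaust_3[of k] by (auto simp: sum_3 wedge_def conn e)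
  finally show "ext_d1 (\<omega> i) c x (e j) (e k) = \<Gamma> i j k (pt c x) - \<Gamma> i k j (pt c x)" .
qed

section \<open>The formula for \<open>A3\<close>, and the mean curvature and flatness of the
  leaves\<close>

text \<open>Since \<open>\<delta> * sin \<xi>\<close> is the sine of
  \<open>\<delta> * \<xi>\<close>, while the cosine is even, the sign \<open>\<delta>\<close>
  amounts to replacing \<open>\<xi>\<close> by \<open>\<delta> * \<xi>\<close>; this is the source
  of the factor \<open>\<delta>\<close> before the last sine. As \<open>leaf_H\<close> is a trace,
  \<open>A3\<close> is half of it, the average of the principal curvatures.\<close>

theorem proposition10:
  fixes M :: "('m::{t2_space,second_countable_topology}, real^3) chart set"
    and \<omega> :: "3 \<Rightarrow> ('m, real^3) one_form"
    and A3 B1 B2 B3 C \<xi> :: "'m \<Rightarrow> real"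
    and \<epsilon> \<delta> :: real
    and \<Gamma> :: "3 \<Rightarrow> 3 \<Rightarrow> 3 \<Rightarrow> 'm \<Rightarrow> real"
  assumes manifold: "smooth_atlas M"
    and coframing: "coframing M \<omega>"
    and smooth: "smooth_function M A3" "smooth_function M B1" "smooth_function M B2"
      "smooth_function M B3" "smooth_function M C" "smooth_function M \<xi>"
    and signs: "\<epsilon> \<in> {1, -1}" "\<delta> \<in> {1, -1}"
    and d\<omega>1: "form_eq M (ext_d1 (\<omega> 1))
      ((A3 - C) \<odot>\<^sub>2 (\<omega> 1 \<^bold>\<and> \<omega> 3) + \<omega> 2 \<^bold>\<and> \<omega> 3)"
    and d\<omega>2: "form_eq M (ext_d1 (\<omega> 2))
      ((\<lambda>p. \<epsilon>) \<odot>\<^sub>2 (\<omega> 1 \<^bold>\<and> \<omega> 3) + (A3 + C) \<odot>\<^sub>2 (\<omega> 2 \<^bold>\<and> \<omega> 3))"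
    and d\<omega>3: "form_eq M (ext_d1 (\<omega> 3))
      (B3 \<odot>\<^sub>2 (\<omega> 1 \<^bold>\<and> \<omega> 2) + B2 \<odot>\<^sub>2 (\<omega> 1 \<^bold>\<and> \<omega> 3) + B1 \<odot>\<^sub>2 (\<omega> 2 \<^bold>\<and> \<omega> 3))"
    and dC: "form_eq M (ext_d0 C)
      ((\<lambda>p. cos (\<xi> p)) \<odot>\<^sub>1 \<omega> 1 + (\<lambda>p. \<delta> * sin (\<xi> p)) \<odot>\<^sub>1 \<omega> 2)"
    and connection: "levi_civita M (coframe_metric \<omega>) \<omega> \<Gamma>"
    and integrable: "\<forall>p\<in>points M. B3 p = 0"
  shows "(\<forall>p\<in>points M.
            A3 p = C p * cos (2 * \<xi> p) - 1/2 * \<delta> * (\<epsilon> + 1) * sin (2 * \<xi> p)) \<and>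
         (\<forall>(S :: ('s::{t2_space,second_countable_topology}, real^2) chart set) \<iota>.
            integral_surface M (\<omega> 3) S \<iota> \<longrightarrow>
              flat_leaf M \<omega> \<Gamma> S \<iota> \<and>
              (\<forall>q\<in>points S. leaf_H \<Gamma> \<iota> q / 2 = A3 (\<iota> q)))"
proof -
  have one_form: "is_one_form M (\<omega> i)" for i
    using coframing by (simp add: coframing_def)
  have B3: "B3 (pt c x) = 0" if "c \<in> M" "x \<in> coord_range c" for c x
    using integrable pt_in_points[OF manifold that] by blast
  have d1: "ext_d1 (\<omega> 1) c x v w = (A3 (pt c x) - C (pt c x)) * (\<omega> 1 \<^bold>\<and> \<omega> 3) c x v w +
      (\<omega> 2 \<^bold>\<and> \<omega> 3) c x v w"
    and d2: "ext_d1 (\<omega> 2) c x v w = \<epsilon> * (\<omega> 1 \<^bold>\<and> \<omega> 3) c x v w +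
      (A3 (pt c x) + C (pt c x)) * (\<omega> 2 \<^bold>\<and> \<omega> 3) c x v w"
    and d3: "ext_d1 (\<omega> 3) c x v w = B2 (pt c x) * (\<omega> 1 \<^bold>\<and> \<omega> 3) c x v w +
      B1 (pt c x) * (\<omega> 2 \<^bold>\<and> \<omega> 3) c x v w"
    if "c \<in> M" "x \<in> coord_range c" for c x v w
    using d\<omega>1 d\<omega>2 d\<omega>3 that B3[OF that] by (simp_all add: form_eq_def scale2_def)
  have A3_eq: "A3 p = C p * cos (2 * \<xi> p) - 1/2 * \<delta> * (\<epsilon> + 1) * sin (2 * \<xi> p)"
    if p_in: "p \<in> points M" for p
  proof -
    obtain c x where c: "c \<in> M" and x: "x \<in> coord_range c" and p: "pt c x = p"
      using points_cases[OF manifold p_in] .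
    obtain e where e: "\<And>i j. \<omega> i c x (e j) = (if i = j then 1 else 0)"
      by (rule coframing_dual_basis[OF coframing c x]) (rule that)
    define D where "D = ext_d0 \<xi> c x"
    note d\<xi> = ext_d0_has_derivative[OF smooth(6) c x, folded D_def]
    have dcos: "((\<lambda>x. cos (\<xi> (pt c x))) has_derivative (\<lambda>v. - sin (\<xi> p) * D v)) (at x)"
      and dsin: "((\<lambda>x. \<delta> * sin (\<xi> (pt c x))) has_derivative (\<lambda>v. \<delta> * cos (\<xi> p) * D v)) (at x)"
      using p by (auto intro!: derivative_eq_intros d\<xi>)
    let ?\<alpha> = "(\<lambda>p. cos (\<xi> p)) \<odot>\<^sub>1 \<omega> 1" and ?\<beta> = "(\<lambda>p. \<delta> * sin (\<xi> p)) \<odot>\<^sub>1 \<omega> 2"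
    have "(ext_d1 ?\<alpha> + ext_d1 ?\<beta>) c x v w = 0" for v w
    proof -
      have "(ext_d1 ?\<alpha> + ext_d1 ?\<beta>) c x v w = ext_d1 (?\<alpha> + ?\<beta>) c x v w"
        by (rule ext_d1_add[symmetric]; rule differentiableI)
          (rule scale1_has_derivative[OF dcos one_form c x] scale1_has_derivative[OF dsin one_form c x])+
      also have "\<dots> = ext_d1 (ext_d0 C) c x v w"
        using form_eq_ext_d1[OF manifold dC] c x by (simp add: form_eq_def)
      also have "\<dots> = 0"
        using ext_d1_ext_d0[OF manifold smooth(5)] c x by (simp add: form_eq_def)
      finally show ?thesis .
    qed
    then have dd: "ext_d1 ?\<alpha> c x v w + ext_d1 ?\<beta> c x v w = 0" for v w
      by simp
    \<comment> \<open>Both \<open>\<omega> 1\<close> and \<open>\<omega> 2\<close> vanish on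
      \<open>e 3\<close>, so pairs containing \<open>e 3\<close> involve only the component
      \<open>D (e 3)\<close> of the differential of \<open>\<xi>\<close>. Its sign is reversed
      because \<open>e 3\<close> stands in the second slot of the wedge product.\<close>
    have eq13: "sin (\<xi> p) * D (e 3) + cos (\<xi> p) * (A3 p - C p) + \<delta> * sin (\<xi> p) * \<epsilon> = 0"
      using dd[of "e 1" "e 3"]
      by (simp add: ext_d1_scale1[OF dcos one_form c x] ext_d1_scale1[OF dsin one_form c x]
          ext_d0_eqI[of "\<lambda>p. cos (\<xi> p)", OF dcos] ext_d0_eqI[of "\<lambda>p. \<delta> * sin (\<xi> p)", OF dsin]
          scale2_def d1[OF c x] d2[OF c x] wedge_def e p)
    have eq23: "- \<delta> * cos (\<xi> p) * D (e 3) + cos (\<xi> p) + \<delta> * sin (\<xi> p) * (A3 p + C p) = 0"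
      using dd[of "e 2" "e 3"]
      by (simp add: ext_d1_scale1[OF dcos one_form c x] ext_d1_scale1[OF dsin one_form c x]
          ext_d0_eqI[of "\<lambda>p. cos (\<xi> p)", OF dcos] ext_d0_eqI[of "\<lambda>p. \<delta> * sin (\<xi> p)", OF dsin]
          scale2_def d1[OF c x] d2[OF c x] wedge_def e p)
    \<comment> \<open>In \<open>cos \<xi>\<close> times \<open>eq13\<close> plus
      \<open>\<delta> * sin \<xi>\<close> times \<open>eq23\<close>, this identity cancels
      \<open>D (e 3)\<close>; together with the Pythagorean identity it makes the coefficient of
      \<open>A3 p\<close> equal to 1.\<close>
    have "\<delta> * \<delta> = 1"
      using signs(2) by auto
    moreover have "sin (\<xi> p) * sin (\<xi> p) + cos (\<xi> p) * cos (\<xi> p) = 1"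
      using sin_cos_squared_add[of "\<xi> p"] by (simp add: power2_eq_square)
    ultimately have "A3 p - C p * (cos (\<xi> p) * cos (\<xi> p) - sin (\<xi> p) * sin (\<xi> p)) +
        \<delta> * (\<epsilon> + 1) * (sin (\<xi> p) * cos (\<xi> p)) = 0"
      using eq13 eq23 by algebra
    then show ?thesis
      by (simp add: cos_double sin_double power2_eq_square)
  qed
  have conn: "\<Gamma> 1 2 1 (pt c x) = 0 \<and> \<Gamma> 1 2 2 (pt c x) = 0 \<and>
      \<Gamma> 3 1 1 (pt c x) + \<Gamma> 3 2 2 (pt c x) = 2 * A3 (pt c x)"
    if c: "c \<in> M" and x: "x \<in> coord_range c" for c x
  proof -
    obtain e where e: "\<And>i j. \<omega> i c x (e j) = (if i = j then 1 else 0)"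
      by (rule coframing_dual_basis[OF coframing c x]) (rule that)
    note skew = levi_civita_coefficients(1)[OF connection c x, of e, OF e]
    note struct = levi_civita_coefficients(2)[OF connection c x, of e, OF e]
    show ?thesis
      \<comment> \<open>In each of these four structure equations one coefficient has equal first
        two indices and vanishes by skew symmetry, which isolates the other. In the trace,
        \<open>A3 - C\<close> and \<open>A3 + C\<close> add up and \<open>C\<close> cancels.\<close>
      using struct[of 1 1 2] struct[of 2 1 2] struct[of 1 1 3] struct[of 2 2 3]
        skew[of 1 1] skew[of 2 2] skew[of 2 1] skew[of 3 1 1] skew[of 3 2 2]
      by (simp add: d1[OF c x] d2[OF c x] wedge_def e)
  qed
  have leaf: "flat_leaf M \<omega> \<Gamma> S \<iota> \<and> (\<forall>q\<in>points S. leaf_H \<Gamma> \<iota> q / 2 = A3 (\<iota> q))"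
    if "integral_surface M (\<omega> 3) S \<iota>" for S :: "('s, real^2) chart set" and \<iota>
  proof
    have S: "smooth_atlas S" and \<iota>: "\<iota> ` points S \<subseteq> points M"
      and tangent: "form_eq S (pullback1 M \<iota> (\<omega> 3)) 0"
      using that by (auto simp: integral_surface_def immersion_def smooth_map_def)
    show "\<forall>q\<in>points S. leaf_H \<Gamma> \<iota> q / 2 = A3 (\<iota> q)"
    proof
      fix q assume "q \<in> points S"
      then have "\<iota> q \<in> points M"
        using \<iota> by blast
      then obtain c x where "c \<in> M" "x \<in> coord_range c" "pt c x = \<iota> q"
        using points_cases[OF manifold] by blast
      then show "leaf_H \<Gamma> \<iota> q / 2 = A3 (\<iota> q)"
        using conn by (fastforce simp: leaf_H_def)
    qed
    have "form_eq M (connection_form \<Gamma> \<omega> 1 2) (\<Gamma> 1 2 3 \<odot>\<^sub>1 \<omega> 3)"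
      using conn by (auto simp: form_eq_def connection_form_def sum_3 scale1_def fun_eq_iff)
    then have d12: "form_eq M (ext_d1 (connection_form \<Gamma> \<omega> 1 2)) (ext_d1 (\<Gamma> 1 2 3 \<odot>\<^sub>1 \<omega> 3))"
      by (rule form_eq_ext_d1[OF manifold])
    have \<Gamma>: "smooth_function M (\<Gamma> 1 2 3)"
      using connection by (simp add: levi_civita_def)
    \<comment> \<open>By the product rule and \<open>d3\<close>, every term of the differential of
      \<open>\<Gamma> 1 2 3 \<odot>\<^sub>1 \<omega> 3\<close> contains the factor
      \<open>\<omega> 3\<close>, so it vanishes on two vectors from the kernel of
      \<open>\<omega> 3\<close>.\<close>
    have zero: "ext_d1 (connection_form \<Gamma> \<omega> 1 2) c x v w = 0"
      if c: "c \<in> M" and x: "x \<in> coord_range c" and "\<omega> 3 c x v = 0" "\<omega> 3 c x w = 0" for c x v w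
    proof -
      have "ext_d1 (connection_form \<Gamma> \<omega> 1 2) c x v w = ext_d1 (\<Gamma> 1 2 3 \<odot>\<^sub>1 \<omega> 3) c x v w"
        using d12 c x by (simp add: form_eq_def)
      also have "\<dots> = 0"
        using that(3,4) by (simp add: ext_d1_scale1[OF ext_d0_has_derivative[OF \<Gamma> c x] one_form c x]
            scale2_def d3[OF c x] wedge_def)
      finally show ?thesis .
    qed
    show "flat_leaf M \<omega> \<Gamma> S \<iota>"
      unfolding flat_leaf_def form_eq_def
    proof (intro ballI ext)
      fix d y v w
      assume d: "d \<in> S" and y: "y \<in> coord_range d"
      \<comment> \<open>This is the chart in which both pullbacks at \<open>y\<close> are computed.
        Tangency therefore says directly that the images of tangent vectors lie in the kernel of
        \<open>\<omega> 3 c (F y)\<close>, as \<open>zero\<close> requires.\<close>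
      define c where "c = chart_at M (\<iota> (pt d y))"
      define F where "F = local_rep \<iota> d c"
      have "\<iota> (pt d y) \<in> points M"
        using \<iota> pt_in_points[OF S d y] by blast
      from chart_at[OF this] have c: "c \<in> M" and "\<iota> (pt d y) \<in> fst c"
        unfolding c_def .
      then have Fy: "F y \<in> coord_range c"
        by (simp add: F_def local_rep_def coord_range_def)
      have "pullback1 M \<iota> (\<omega> 3) d y u = 0" for u
        using tangent d y by (simp add: form_eq_def)
      then have "\<omega> 3 c (F y) (frechet_derivative F (at y) u) = 0" for u
        by (simp add: pullback1_def Let_def c_def F_def)
      then show "pullback2 M \<iota> (ext_d1 (connection_form \<Gamma> \<omega> 1 2)) d y v w = 0 d y v w"
        using zero[OF c Fy] by (simp add: pullback2_def Let_def c_def F_def)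
    qed
  qed
  show ?thesis
    using A3_eq leaf by blast
qed

end
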